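(* Let $f$ be a holomorphic function on $\mathbb{D}^2$ with $f(0)=0$ and $\sup_{z\in\mathbb{D}^2}|f(z)|\le 1$. Let $B$ be the bilateral shift on $\ell^2(\mathbb{Z})$. Then \[\left\|\mathscr{T}\left(\frac{\partial f}{\partial z_1}(0)I+\frac{\partial f}{\partial z_2}(0)B^*,\ \frac12\frac{\partial^2f}{\partial z_1^2}(0)I+\frac{\partial^2f}{\partial z_1\partial z_2}(0)B^*+\frac12\frac{\partial^2f}{\partial z_2^2}(0){B^*}^2\right)\right\|\le 1.\]
   Context: For bounded operators $A_1,A_2$ on a Hilbert space, $\mathscr{T}(A_1,A_2)=\begin{pmatrix}A_1&A_2\\0&A_1\end{pmatrix}$. $\mathbb{D}$ is the open unit disc. *)

theory Defs
  imports "HOL-Analysis.Analysis"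
begin

section \<open>The complex Hilbert space of square-summable families\<close>

typedef 'a ell2 = "{x :: 'a \<Rightarrow> complex. (\<lambda>i. (cmod (x i))\<^sup>2) summable_on UNIV}"
  morphisms coord Abs_ell2
  by (rule exI[of _ "\<lambda>_. 0"]) simp

setup_lifting type_definition_ell2

lemma coord_square_summable: "(\<lambda>i. (cmod (coord x i))\<^sup>2) summable_on UNIV"
  using coord[of x] by simp

lemma ell2_eqI: "(\<And>i. coord x i = coord y i) \<Longrightarrow> x = y"
  by (simp add: coord_inject[symmetric] fun_eq_iff)

lemma square_summable_add:
  fixes x y :: "'a \<Rightarrow> complex"
  assumes "(\<lambda>i. (cmod (x i))\<^sup>2) summable_on UNIV" "(\<lambda>i. (cmod (y i))\<^sup>2) summable_on UNIV"
  shows "(\<lambda>i. (cmod (x i + y i))\<^sup>2) summable_on UNIV"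
proof (rule summable_on_comparison_test)
  show "(\<lambda>i. 2 * (cmod (x i))\<^sup>2 + 2 * (cmod (y i))\<^sup>2) summable_on UNIV"
    by (intro summable_on_add summable_on_cmult_right assms)
  fix i
  have "(cmod (x i + y i))\<^sup>2 \<le> (cmod (x i) + cmod (y i))\<^sup>2"
    by (intro power_mono norm_triangle_ineq) simp
  also have "\<dots> \<le> 2 * (cmod (x i))\<^sup>2 + 2 * (cmod (y i))\<^sup>2"
    using sum_squares_bound[of "cmod (x i)" "cmod (y i)"] by (simp add: power2_sum)
  finally show "(cmod (x i + y i))\<^sup>2 \<le> 2 * (cmod (x i))\<^sup>2 + 2 * (cmod (y i))\<^sup>2" .
qed simp

lemma square_summable_cmult:
  fixes x :: "'a \<Rightarrow> complex"
  assumes "(\<lambda>i. (cmod (x i))\<^sup>2) summable_on UNIV"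
  shows "(\<lambda>i. (cmod (c * x i))\<^sup>2) summable_on UNIV"
  using summable_on_cmult_right[OF assms, of "(cmod c)\<^sup>2"] by (simp add: norm_mult power_mult_distrib)

definition cinner :: "'a ell2 \<Rightarrow> 'a ell2 \<Rightarrow> complex"
  where "cinner x y = (\<Sum>\<^sub>\<infinity>i. coord x i * cnj (coord y i))"

lift_definition scaleC :: "complex \<Rightarrow> 'a ell2 \<Rightarrow> 'a ell2" is "\<lambda>c x i. c * x i"
  by (rule square_summable_cmult)

lemma cinner_summable: "(\<lambda>i. coord x i * cnj (coord y i)) summable_on UNIV"
proof -
  have "(\<lambda>i. norm (coord x i * cnj (coord y i))) summable_on UNIV"
  proof (rule summable_on_comparison_test)
    show "(\<lambda>i. (cmod (coord x i))\<^sup>2 + (cmod (coord y i))\<^sup>2) summable_on UNIV"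
      by (intro summable_on_add coord_square_summable)
    fix i
    have "0 \<le> cmod (coord x i) * cmod (coord y i)" by simp
    with sum_squares_bound[of "cmod (coord x i)" "cmod (coord y i)"]
    show "norm (coord x i * cnj (coord y i)) \<le> (cmod (coord x i))\<^sup>2 + (cmod (coord y i))\<^sup>2"
      unfolding norm_mult complex_mod_cnj by linarith
  qed simp
  then show ?thesis
    by (simp add: summable_on_iff_abs_summable_on_complex)
qed

instantiation ell2 :: (type) real_vector
begin

lift_definition zero_ell2 :: "'a ell2" is "\<lambda>_. 0" by simp

lift_definition plus_ell2 :: "'a ell2 \<Rightarrow> 'a ell2 \<Rightarrow> 'a ell2" is "\<lambda>x y i. x i + y i"
  by (rule square_summable_add)

lift_definition uminus_ell2 :: "'a ell2 \<Rightarrow> 'a ell2" is "\<lambda>x i. - x i" by simp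

lift_definition minus_ell2 :: "'a ell2 \<Rightarrow> 'a ell2 \<Rightarrow> 'a ell2" is "\<lambda>x y i. x i - y i"
  subgoal for x y using square_summable_add[of x "\<lambda>i. - y i"] by simp
  done

lift_definition scaleR_ell2 :: "real \<Rightarrow> 'a ell2 \<Rightarrow> 'a ell2" is "\<lambda>r x i. of_real r * x i"
  by (rule square_summable_cmult)

instance
  by standard (transfer; simp add: fun_eq_iff algebra_simps)+

end

instantiation ell2 :: (type) real_inner
begin

definition inner_ell2 :: "'a ell2 \<Rightarrow> 'a ell2 \<Rightarrow> real"
  where "inner_ell2 x y = Re (cinner x y)"

definition norm_ell2 :: "'a ell2 \<Rightarrow> real"
  where "norm_ell2 x = sqrt (\<Sum>\<^sub>\<infinity>i. (cmod (coord x i))\<^sup>2)"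

definition sgn_ell2 :: "'a ell2 \<Rightarrow> 'a ell2"
  where "sgn_ell2 x = x /\<^sub>R norm x"

definition dist_ell2 :: "'a ell2 \<Rightarrow> 'a ell2 \<Rightarrow> real"
  where "dist_ell2 x y = norm (x - y)"

definition uniformity_ell2 :: "('a ell2 \<times> 'a ell2) filter"
  where "uniformity_ell2 = (INF e\<in>{0<..}. principal {(x, y). dist x y < e})"

definition open_ell2 :: "'a ell2 set \<Rightarrow> bool"
  where "open_ell2 U \<longleftrightarrow> (\<forall>x\<in>U. eventually (\<lambda>(x', y). x' = x \<longrightarrow> y \<in> U) uniformity)"

instance
proof
  fix x y z :: "'a ell2" and r :: real and U :: "'a ell2 set"
  show "sgn x = x /\<^sub>R norm x" by (rule sgn_ell2_def)
  show "dist x y = norm (x - y)" by (rule dist_ell2_def)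
  show "(uniformity :: ('a ell2 \<times> 'a ell2) filter)
      = (INF e\<in>{0<..}. principal {(x, y). dist x y < e})"
    by (rule uniformity_ell2_def)
  show "open U \<longleftrightarrow> (\<forall>x\<in>U. eventually (\<lambda>(x', y). x' = x \<longrightarrow> y \<in> U) uniformity)"
    by (rule open_ell2_def)
  have "cinner x y = cnj (cinner y x)"
    unfolding cinner_def by (simp flip: infsum_cnj add: mult.commute)
  then show "inner x y = inner y x" by (simp add: inner_ell2_def)
  have "cinner (x + y) z = cinner x z + cinner y z"
    unfolding cinner_def
    by (simp add: plus_ell2.rep_eq distrib_right infsum_add cinner_summable)
  then show "inner (x + y) z = inner x z + inner y z" by (simp add: inner_ell2_def)
  have "cinner (r *\<^sub>R x) y = of_real r * cinner x y"
    unfolding cinner_def by (simp add: scaleR_ell2.rep_eq mult.assoc infsum_cmult_right')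
  then show "inner (r *\<^sub>R x) y = r * inner x y" by (simp add: inner_ell2_def)
  have *: "inner x x = (\<Sum>\<^sub>\<infinity>i. (cmod (coord x i))\<^sup>2)"
  proof -
    have "inner x x = (\<Sum>\<^sub>\<infinity>i. Re (coord x i * cnj (coord x i)))"
      unfolding inner_ell2_def cinner_def by (rule infsum_Re[OF cinner_summable, symmetric])
    then show ?thesis by (simp add: complex_mult_cnj cmod_power2 flip: power2_eq_square)
  qed
  show "inner x x \<ge> 0" unfolding * by (rule infsum_nonneg) simp
  show "inner x x = 0 \<longleftrightarrow> x = 0"
  proof
    assume "inner x x = 0"
    then have "(cmod (coord x i))\<^sup>2 = 0" for i
      using nonneg_infsum_le_0D[of "\<lambda>i. (cmod (coord x i))\<^sup>2" UNIV i]
      by (simp add: * coord_square_summable)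
    then show "x = 0" by (intro ell2_eqI) (simp add: zero_ell2.rep_eq)
  next
    assume "x = 0"
    then have "coord x i = 0" for i by (simp add: zero_ell2.rep_eq)
    then show "inner x x = 0" unfolding * by simp
  qed
  show "norm x = sqrt (inner x x)" by (simp add: * norm_ell2_def)
qed

end

lemma norm_scaleC: "norm (scaleC c x) = cmod c * norm x"
  by (simp add: norm_ell2_def scaleC.rep_eq norm_mult power_mult_distrib infsum_cmult_right'
      real_sqrt_mult)

lemma bounded_linear_scaleC: "bounded_linear (scaleC c)"
proof (rule bounded_linear_intro[where K = "cmod c"])
  fix x y :: "'a ell2" and r
  show "scaleC c (x + y) = scaleC c x + scaleC c y" "scaleC c (r *\<^sub>R x) = r *\<^sub>R scaleC c x"
    by (transfer; simp add: fun_eq_iff algebra_simps)+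
qed (simp add: norm_scaleC)


section \<open>Bounded operators\<close>

text \<open>
  Bounded operators are elements of the type \<open>_ \<Rightarrow>\<^sub>L _\<close>, with its operator norm. This type only
  demands real linearity; the norm is the same supremum as for complex-linear operators.
\<close>

definition cscale_op :: "complex \<Rightarrow> 'a ell2 \<Rightarrow>\<^sub>L 'a ell2 \<Rightarrow> 'a ell2 \<Rightarrow>\<^sub>L 'a ell2"
    (infixr "*\<^sub>C" 75)
  where "c *\<^sub>C A = Blinfun (\<lambda>x. scaleC c (blinfun_apply A x))"

lemma blinfun_apply_cscale_op: "blinfun_apply (c *\<^sub>C A) x = scaleC c (blinfun_apply A x)"
  by (simp add: cscale_op_def bounded_linear_Blinfun_apply blinfun.bounded_linear_right
      bounded_linear_compose[OF bounded_linear_scaleC])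

definition adj :: "'a ell2 \<Rightarrow>\<^sub>L 'a ell2 \<Rightarrow> 'a ell2 \<Rightarrow>\<^sub>L 'a ell2"
  where "adj A = (THE S. \<forall>x y. cinner (blinfun_apply A x) y = cinner x (blinfun_apply S y))"

lemma bij_shift: "bij (\<lambda>n::int. n + k)"
  by (rule bij_betw_byWitness[where f' = "\<lambda>n. n - k"]) auto

lift_definition translate :: "int \<Rightarrow> int ell2 \<Rightarrow> int ell2" is "\<lambda>k x n. x (n + k)"
  subgoal for k x
    using summable_on_reindex_bij_betw[OF bij_shift, of "\<lambda>n. (cmod (x n))\<^sup>2" k] by simp
  done

lemma norm_translate: "norm (translate k x) = norm x"
  using infsum_reindex_bij_betw[OF bij_shift, of "\<lambda>n. (cmod (coord x n))\<^sup>2" k]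
  by (simp add: norm_ell2_def translate.rep_eq)

lemma bounded_linear_translate: "bounded_linear (translate k)"
proof (rule bounded_linear_intro[where K = 1])
  fix x y r
  show "translate k (x + y) = translate k x + translate k y"
    "translate k (r *\<^sub>R x) = r *\<^sub>R translate k x"
    by (transfer; simp)+
qed (simp add: norm_translate)

text \<open>The bilateral shift sends the basis vector \<open>e\<^sub>n\<close> to \<open>e\<^sub>n\<^sub>+\<^sub>1\<close>, i.e. \<open>(B x)\<^sub>n = x\<^sub>n\<^sub>-\<^sub>1\<close>.\<close>

definition bilateral_shift :: "int ell2 \<Rightarrow>\<^sub>L int ell2"
  where "bilateral_shift = Blinfun (translate (- 1))"

text \<open>The description in \<open>adj\<close> is not void for the shift:\<close>

lemma adj_bilateral_shift: "adj bilateral_shift = Blinfun (translate 1)"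
  unfolding adj_def
proof (rule the_equality)
  have ap: "blinfun_apply (Blinfun (translate k)) y = translate k y" for k y
    by (simp add: bounded_linear_Blinfun_apply bounded_linear_translate)
  show *: "\<forall>x y. cinner (blinfun_apply bilateral_shift x) y
      = cinner x (blinfun_apply (Blinfun (translate 1)) y)"
  proof (intro allI)
    fix x y
    show "cinner (blinfun_apply bilateral_shift x) y
        = cinner x (blinfun_apply (Blinfun (translate 1)) y)"
      using infsum_reindex_bij_betw[OF bij_shift,
          of "\<lambda>n. coord x n * cnj (coord y (n + 1))" "- 1"]
      by (simp add: ap bilateral_shift_def cinner_def translate.rep_eq)
  qed
  fix S
  assume S: "\<forall>x y. cinner (blinfun_apply bilateral_shift x) y = cinner x (blinfun_apply S y)"
  show "S = Blinfun (translate 1)"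
  proof (rule blinfun_eqI)
    fix y
    have "cinner x (blinfun_apply S y) = cinner x (blinfun_apply (Blinfun (translate 1)) y)" for x
      by (rule trans[OF S[rule_format, symmetric] *[rule_format]])
    then have "\<forall>x. inner x (blinfun_apply S y) = inner x (blinfun_apply (Blinfun (translate 1)) y)"
      by (simp only: inner_ell2_def simp_thms)
    then show "blinfun_apply S y = blinfun_apply (Blinfun (translate 1)) y"
      by (simp only: vector_eq_ldot)
  qed
qed

text \<open>
  The norm of the product type is \<open>norm (x, y) = sqrt ((norm x)\<^sup>2 + (norm y)\<^sup>2)\<close>, so \<open>'h \<times> 'h\<close> is the
  orthogonal direct sum.
\<close>

definition block_op ::
    "'h::real_inner \<Rightarrow>\<^sub>L 'h \<Rightarrow> 'h \<Rightarrow>\<^sub>L 'h \<Rightarrow> ('h \<times> 'h) \<Rightarrow>\<^sub>L ('h \<times> 'h)"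
  where "block_op A1 A2 =
    Blinfun (\<lambda>(x, y). (blinfun_apply A1 x + blinfun_apply A2 y, blinfun_apply A1 y))"

lemma blinfun_apply_block_op:
  "blinfun_apply (block_op A1 A2) (x, y) = (blinfun_apply A1 x + blinfun_apply A2 y, blinfun_apply A1 y)"
proof -
  note A = blinfun.bounded_linear_right[of A1] blinfun.bounded_linear_right[of A2]
  have "bounded_linear (\<lambda>(x, y). (blinfun_apply A1 x + blinfun_apply A2 y, blinfun_apply A1 y))"
    unfolding case_prod_beta
    by (rule bounded_linear_Pair[OF bounded_linear_add[OF
        bounded_linear_compose[OF A(1) bounded_linear_fst]
        bounded_linear_compose[OF A(2) bounded_linear_snd]]
        bounded_linear_compose[OF A(1) bounded_linear_snd]])
  then show ?thesis by (simp add: block_op_def bounded_linear_Blinfun_apply)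
qed


section \<open>Holomorphic functions of two variables\<close>

definition bidisc :: "(complex \<times> complex) set"
  where "bidisc = ball 0 1 \<times> ball 0 1"

text \<open>Complex differentiability: the total derivative exists and is complex linear.\<close>

definition holomorphic2_on :: "(complex \<times> complex \<Rightarrow> complex) \<Rightarrow> (complex \<times> complex) set \<Rightarrow> bool"
    (infixl "holomorphic'2'_on" 50)
  where "f holomorphic2_on S \<longleftrightarrow>
    (\<forall>z\<in>S. \<exists>a b. (f has_derivative (\<lambda>(h, k). a * h + b * k)) (at z within S))"

definition pd1 :: "(complex \<times> complex \<Rightarrow> complex) \<Rightarrow> complex \<times> complex \<Rightarrow> complex"
  where "pd1 f = (\<lambda>(z1, z2). deriv (\<lambda>w. f (w, z2)) z1)"

definition pd2 :: "(complex \<times> complex \<Rightarrow> complex) \<Rightarrow> complex \<times> complex \<Rightarrow> complex"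
  where "pd2 f = (\<lambda>(z1, z2). deriv (\<lambda>w. f (z1, w)) z2)"

end

theory Submission
  imports Defs "HOL-Complex_Analysis.Complex_Analysis"
begin

text \<open>
  Put \<open>p1 w = \<partial>1 f + \<partial>2 f * w\<close> and \<open>p2 w = \<partial>1\<partial>1 f / 2 + \<partial>1\<partial>2 f * w + \<partial>2\<partial>2 f / 2 * w\<^sup>2\<close>, with all derivatives
  taken at the origin. The operator in question is the upper triangular Toeplitz operator with
  entries \<open>p1 S\<close> and \<open>p2 S\<close>, where \<open>S\<close> is the adjoint of the bilateral shift. As \<open>S\<close> is unitarily
  equivalent to multiplication by the coordinate on the unit circle, the norm is the supremum over
  \<open>cmod w = 1\<close> of the norms of the scalar matrices with rows \<open>(p1 w, p2 w)\<close> and \<open>(0, p1 w)\<close>. Such a matrix is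
  a contraction as soon as \<open>cmod (p2 w) \<le> 1 - (cmod (p1 w))\<^sup>2\<close>.

  This inequality is the Schwarz-Pick lemma at the origin. The function \<open>z \<mapsto> f (z, w * z)\<close> has the
  expansion \<open>p1 w * z + p2 w * z\<^sup>2 + \<dots>\<close>, so by the Schwarz lemma \<open>p1 w + p2 w * z + \<dots>\<close> is a holomorphic map
  from the disc to the closed disc (\<open>symbol_Schwarz_Pick\<close>). That its second-order coefficient really is
  \<open>p2 w\<close> comes from \<open>diagonal_expansion\<close>, which obtains the Taylor expansion in the second variable by
  iterating difference quotients: these preserve separate holomorphy and boundedness
  (\<open>sep_holomorphic_bounded_divdiff\<close>).

  The spectral part (\<open>norm_block_op_translation_le_1\<close>) uses only finite Fourier analysis: square-summable
  sequences are truncated to a finite window, where the discrete Parseval identity over roots of unity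
  (\<open>finite_Parseval\<close>) replaces integration over the circle.
\<close>

section \<open>Bounded holomorphic functions on the disc\<close>

text \<open>
  The value at the origin fills the removable singularity, so that the difference quotient of a
  holomorphic function is again holomorphic on the whole disc.
\<close>

definition divdiff :: "(complex \<Rightarrow> complex) \<Rightarrow> complex \<Rightarrow> complex"
  where "divdiff \<phi> z = (if z = 0 then deriv \<phi> 0 else (\<phi> z - \<phi> 0) / z)"

lemma divdiff_expand: "\<phi> z = \<phi> 0 + z * divdiff \<phi> z"
  by (simp add: divdiff_def)

lemma divdiff_0: "divdiff \<phi> 0 = deriv \<phi> 0"
  by (simp add: divdiff_def)

lemma holomorphic_divdiff:
  assumes "\<phi> holomorphic_on ball 0 1"
  shows "divdiff \<phi> holomorphic_on ball 0 1"
proof (rule pole_theorem_open_0[where g = "\<lambda>z. \<phi> z - \<phi> 0" and a = 0])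
  show "(\<lambda>z. \<phi> z - \<phi> 0) holomorphic_on ball 0 1"
    by (intro holomorphic_intros assms)
  have "\<phi> field_differentiable at 0"
    using assms by (simp add: holomorphic_on_imp_differentiable_at)
  then have "deriv (\<lambda>z. \<phi> z - \<phi> 0) 0 = deriv \<phi> 0"
    by simp
  then show "divdiff \<phi> 0 = deriv (\<lambda>z. \<phi> z - \<phi> 0) 0"
    by (simp add: divdiff_0)
qed (auto simp: divdiff_def)

text \<open>
  This is the Schwarz lemma for \<open>\<phi> - \<phi> 0\<close>: dividing by \<open>z\<close> does not increase the supremum on the
  disc, by the maximum principle on large circles.
\<close>

lemma norm_divdiff_le:
  assumes hol: "\<phi> holomorphic_on ball 0 1"
    and bd: "\<And>z. z \<in> ball 0 1 \<Longrightarrow> cmod (\<phi> z - \<phi> 0) \<le> C"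
    and z: "z \<in> ball 0 1"
  shows "cmod (divdiff \<phi> z) \<le> C"
proof (rule dense_ge)
  \<comment> \<open>Scaling by \<open>D > C\<close> instead of \<open>C\<close> lands in the open unit disc, also when \<open>C = 0\<close>.\<close>
  fix D assume D: "C < D"
  have C0: "0 \<le> C" using bd[of 0] by simp
  with D have D0: "0 < D" by linarith
  define \<psi> where "\<psi> = (\<lambda>z. (\<phi> z - \<phi> 0) / of_real D)"
  have df: "\<phi> field_differentiable at 0"
    using hol by (simp add: holomorphic_on_imp_differentiable_at)
  have h: "\<psi> holomorphic_on ball 0 1"
    unfolding \<psi>_def using D0 by (intro holomorphic_intros hol) auto
  have small: "cmod (\<psi> w) < 1" if "cmod w < 1" for w
    using bd[of w] that D D0 by (simp add: \<psi>_def norm_divide)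
  have S: "cmod (\<psi> w) \<le> cmod w" "cmod (deriv \<psi> 0) \<le> 1" if "cmod w < 1" for w
    using Schwarz_Lemma[OF h _ small that] by (simp_all add: \<psi>_def)
  have "(\<psi> has_field_derivative deriv \<phi> 0 / of_real D) (at 0)"
    unfolding \<psi>_def using df D0
    by (auto intro!: derivative_eq_intros simp: DERIV_deriv_iff_field_differentiable)
  then have d: "deriv \<psi> 0 = deriv \<phi> 0 / of_real D"
    by (rule DERIV_imp_deriv)
  show "cmod (divdiff \<phi> z) \<le> D"
  proof (cases "z = 0")
    case True
    then show ?thesis
      using S(2)[of 0] D0 by (simp add: d divdiff_0 norm_divide)
  next
    case False
    then show ?thesis
      using S(1)[of z] z D0 by (simp add: divdiff_def \<psi>_def norm_divide field_simps)
  qed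
qed

lemma norm_divdiff_le_double:
  assumes "\<phi> holomorphic_on ball 0 1"
    and bd: "\<And>z. z \<in> ball 0 1 \<Longrightarrow> cmod (\<phi> z) \<le> C"
    and "z \<in> ball 0 1"
  shows "cmod (divdiff \<phi> z) \<le> 2 * C"
proof (rule norm_divdiff_le[OF assms(1) _ assms(3)])
  fix w :: complex assume "w \<in> ball 0 1"
  then have "cmod (\<phi> w) \<le> C" "cmod (\<phi> 0) \<le> C"
    using bd by auto
  then show "cmod (\<phi> w - \<phi> 0) \<le> 2 * C"
    using norm_triangle_ineq4[of "\<phi> w" "\<phi> 0"] by linarith
qed

text \<open>
  Compose \<open>q\<close> with the Moebius transformation of the disc that sends \<open>q 0\<close> to \<open>0\<close> and apply the
  Schwarz lemma. The transformation degenerates when \<open>q 0\<close> lies on the unit circle; then the maximum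
  principle makes \<open>q\<close> constant.
\<close>

lemma Schwarz_Pick_origin:
  assumes hol: "q holomorphic_on ball 0 1"
    and bd: "\<And>z. z \<in> ball 0 1 \<Longrightarrow> cmod (q z) \<le> 1"
  shows "cmod (deriv q 0) \<le> 1 - (cmod (q 0))\<^sup>2"
proof (cases "cmod (q 0) = 1")
  case True
  have "q constant_on ball 0 1"
    by (rule Schwarz2[OF hol, of 1 0]) (use bd True in auto)
  then obtain c where c: "\<And>z. z \<in> ball 0 1 \<Longrightarrow> q z = c"
    by (auto simp: constant_on_def)
  have "(q has_field_derivative 0) (at 0)"
    by (rule has_field_derivative_transform_within_open[OF DERIV_const open_ball[of 0 1] _ c[symmetric]]) auto
  then have "deriv q 0 = 0" by (rule DERIV_imp_deriv)
  then show ?thesis using True by simp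
next
  case False
  define a where "a = q 0"
  have a: "cmod a < 1" using False bd[of 0] by (simp add: a_def)
  have nz: "1 - cnj a * q z \<noteq> 0" if "z \<in> ball 0 1" for z
  proof
    assume "1 - cnj a * q z = 0"
    then have "cnj a * q z = 1" by simp
    then have "cmod (cnj a * q z) = 1" by (simp only: norm_one)
    then have "cmod a * cmod (q z) = 1" by (simp add: norm_mult)
    moreover have "cmod a * cmod (q z) \<le> cmod a * 1"
      using bd[OF that] by (intro mult_left_mono) auto
    ultimately show False using a by simp
  qed
  define \<phi> where "\<phi> = (\<lambda>z. (q z - a) / (1 - cnj a * q z))"
  have h: "\<phi> holomorphic_on ball 0 1"
    unfolding \<phi>_def using nz by (intro holomorphic_intros hol) auto
  have le: "cmod (\<phi> z) \<le> 1" if "z \<in> ball 0 1" for z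
  proof -
    have "(cmod (1 - cnj a * q z))\<^sup>2 - (cmod (q z - a))\<^sup>2
        = (1 - (cmod a)\<^sup>2) * (1 - (cmod (q z))\<^sup>2)"
      unfolding cmod_power2 by (simp add: power2_eq_square algebra_simps)
    also have "\<dots> \<ge> 0"
      using a bd[OF that] by (intro mult_nonneg_nonneg) (auto simp: power_le_one)
    finally have "cmod (q z - a) \<le> cmod (1 - cnj a * q z)"
      using power2_le_imp_le[OF _ norm_ge_zero] by (simp only: diff_ge_0_iff_ge)
    then show ?thesis
      using nz[OF that] by (simp add: \<phi>_def norm_divide divide_le_eq_1)
  qed
  have \<phi>0: "\<phi> 0 = 0" by (simp add: \<phi>_def a_def)
  have "cmod (divdiff \<phi> 0) \<le> 1"
    using le by (intro norm_divdiff_le[OF h]) (auto simp: \<phi>0)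
  moreover have "deriv \<phi> 0 = deriv q 0 / of_real (1 - (cmod a)\<^sup>2)"
  proof (rule DERIV_imp_deriv)
    have q: "(q has_field_derivative deriv q 0) (at 0)"
      using hol by (simp add: DERIV_deriv_iff_field_differentiable holomorphic_on_imp_differentiable_at)
    define e where "e = (1 :: complex) - cnj a * a"
    have e: "e = of_real (1 - (cmod a)\<^sup>2)"
      unfolding e_def of_real_diff complex_norm_square by (simp add: mult.commute)
    have e0: "e \<noteq> 0"
      using nz[of 0] by (simp add: e_def a_def)
    have num: "((\<lambda>z. q z - a) has_field_derivative deriv q 0) (at 0)"
      by (auto intro!: derivative_eq_intros q)
    have den: "((\<lambda>z. 1 - cnj a * q z) has_field_derivative - (cnj a * deriv q 0)) (at 0)"
      by (auto intro!: derivative_eq_intros q)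
    have "(\<phi> has_field_derivative
        (deriv q 0 * (1 - cnj a * q 0) - (q 0 - a) * - (cnj a * deriv q 0))
          / ((1 - cnj a * q 0) * (1 - cnj a * q 0))) (at 0)"
      unfolding \<phi>_def by (rule DERIV_divide[OF num den]) (use nz[of 0] in simp)
    moreover have "(deriv q 0 * (1 - cnj a * q 0) - (q 0 - a) * - (cnj a * deriv q 0))
          / ((1 - cnj a * q 0) * (1 - cnj a * q 0)) = deriv q 0 / e"
      using e0 by (simp add: e_def flip: a_def)
    ultimately show "(\<phi> has_field_derivative deriv q 0 / of_real (1 - (cmod a)\<^sup>2)) (at 0)"
      unfolding e by simp
  qed
  ultimately have "cmod (deriv q 0) / \<bar>1 - (cmod a)\<^sup>2\<bar> \<le> 1"
    by (simp only: divdiff_0 norm_divide norm_of_real)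
  moreover have "0 < 1 - (cmod a)\<^sup>2"
    using a by (simp add: power_less_one_iff)
  ultimately show ?thesis
    by (simp add: a_def divide_le_eq_1)
qed

section \<open>Separately holomorphic functions of two variables\<close>

text \<open>
  These three conditions together are stable under forming difference quotients in the second
  variable, which is how the Taylor coefficients are reached below.
\<close>

definition sep_holomorphic_bounded :: "real \<Rightarrow> (complex \<Rightarrow> complex \<Rightarrow> complex) \<Rightarrow> bool"
  where "sep_holomorphic_bounded C F \<longleftrightarrow>
    (\<forall>u\<in>ball 0 1. F u holomorphic_on ball 0 1) \<and>
    (\<forall>v\<in>ball 0 1. (\<lambda>u. F u v) holomorphic_on ball 0 1) \<and>
    (\<forall>u\<in>ball 0 1. \<forall>v\<in>ball 0 1. cmod (F u v) \<le> C)"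

text \<open>
  The only point that is not immediate is that the quotient at \<open>v = 0\<close>, which is the partial derivative
  in the second variable, is holomorphic in \<open>u\<close>. The Schwarz lemma bounds the difference between the
  quotients at \<open>v\<close> and at \<open>0\<close> by \<open>4 * C * cmod v\<close>, with a constant that does not depend on \<open>u\<close>; so the
  partial derivative is a uniform limit of functions holomorphic in \<open>u\<close>.
\<close>

lemma sep_holomorphic_bounded_divdiff:
  assumes F: "sep_holomorphic_bounded C F"
  shows "sep_holomorphic_bounded (2 * C) (\<lambda>u. divdiff (F u))"
proof -
  note F' = F[unfolded sep_holomorphic_bounded_def]
  define G where "G = (\<lambda>u. divdiff (F u))"
  have hol2: "G u holomorphic_on ball 0 1" if "u \<in> ball 0 1" for u
    unfolding G_def using F' that by (intro holomorphic_divdiff) auto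
  have bd: "cmod (G u v) \<le> 2 * C" if "u \<in> ball 0 1" "v \<in> ball 0 1" for u v
    unfolding G_def using F' that by (intro norm_divdiff_le_double) auto
  have hol1: "(\<lambda>u. G u v) holomorphic_on ball 0 1" if "v \<in> ball 0 1" "v \<noteq> 0" for v
  proof -
    have "(\<lambda>u. (F u v - F u 0) / v) holomorphic_on ball 0 1"
      using F' that by (intro holomorphic_intros) auto
    then show ?thesis
      using that by (simp add: G_def divdiff_def)
  qed
  have near: "cmod (G u v - G u 0) \<le> cmod v * (4 * C)"
    if "u \<in> ball 0 1" "v \<in> ball 0 1" for u v
  proof -
    have "cmod (divdiff (G u) v) \<le> 2 * (2 * C)"
      using that by (intro norm_divdiff_le_double hol2 bd) auto
    then have "cmod v * cmod (divdiff (G u) v) \<le> cmod v * (4 * C)"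
      by (intro mult_left_mono) auto
    then show ?thesis
      using divdiff_expand[of "G u" v] by (simp add: norm_mult)
  qed
  \<comment> \<open>Any null sequence of nonzero points of the disc would do; the shift by two keeps it inside.\<close>
  define v :: "nat \<Rightarrow> complex" where "v = (\<lambda>n. of_real (inverse (of_nat (Suc (Suc n)))))"
  have v: "v n \<in> ball 0 1" "v n \<noteq> 0" for n
    by (auto simp: v_def norm_inverse inverse_less_1_iff simp del: of_nat_Suc of_real_inverse)
  have v0: "(\<lambda>n. cmod (v n) * (4 * C)) \<longlonglongrightarrow> 0"
  proof -
    have "v \<longlonglongrightarrow> of_real 0"
      unfolding v_def by (intro tendsto_of_real LIMSEQ_Suc LIMSEQ_inverse_real_of_nat)
    then show ?thesis
      by (intro tendsto_mult_left_zero) (simp add: tendsto_norm_zero)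
  qed
  have hol10: "(\<lambda>u. G u 0) holomorphic_on ball 0 1"
  proof (rule holomorphic_uniform_sequence[where f = "\<lambda>n u. G u (v n)"])
    show "(\<lambda>u. G u (v n)) holomorphic_on ball 0 1" for n
      by (rule hol1[OF v])
    fix x :: complex assume "x \<in> ball 0 1"
    then obtain d where d: "0 < d" "cball x d \<subseteq> ball 0 1"
      using open_contains_cball open_ball by blast
    have "uniform_limit (cball x d) (\<lambda>n u. G u (v n)) (\<lambda>u. G u 0) sequentially"
    proof (rule uniform_limitI)
      fix e :: real assume "0 < e"
      then have "\<forall>\<^sub>F n in sequentially. cmod (v n) * (4 * C) < e"
        using order_tendstoD(2)[OF v0] by simp
      then show "\<forall>\<^sub>F n in sequentially. \<forall>u\<in>cball x d. dist (G u (v n)) (G u 0) < e"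
      proof eventually_elim
        case (elim n)
        show ?case
        proof
          fix u assume "u \<in> cball x d"
          with d have "u \<in> ball 0 1" by auto
          from near[OF this v(1)] elim show "dist (G u (v n)) (G u 0) < e"
            unfolding dist_norm by (rule le_less_trans)
        qed
      qed
    qed
    with d show "\<exists>d>0. cball x d \<subseteq> ball 0 1 \<and>
        uniform_limit (cball x d) (\<lambda>n u. G u (v n)) (\<lambda>u. G u 0) sequentially"
      by blast
  qed simp
  have "(\<lambda>u. G u w) holomorphic_on ball 0 1" if "w \<in> ball 0 1" for w
    using hol1[OF that] hol10 by (cases "w = 0") auto
  with hol2 bd have "sep_holomorphic_bounded (2 * C) G"
    by (simp add: sep_holomorphic_bounded_def)
  then show ?thesis by (simp add: G_def)
qed

text \<open>
  Differentiate \<open>\<phi> z = \<phi> 0 + z * divdiff \<phi> z\<close> twice at the origin.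
\<close>

lemma half_second_deriv:
  assumes "\<phi> holomorphic_on ball 0 1"
  shows "deriv (divdiff \<phi>) 0 = 1/2 * deriv (deriv \<phi>) 0"
proof -
  define \<psi> where "\<psi> = divdiff \<phi>"
  have \<psi>: "\<psi> holomorphic_on ball 0 1"
    unfolding \<psi>_def by (rule holomorphic_divdiff[OF assms])
  have D: "(\<psi> has_field_derivative deriv \<psi> z) (at z)" if "z \<in> ball 0 1" for z
    using \<psi> that by (simp add: holomorphic_derivI)
  have "(deriv \<psi>) holomorphic_on ball 0 1"
    using \<psi> by (simp add: holomorphic_deriv)
  then have D': "(deriv \<psi> has_field_derivative deriv (deriv \<psi>) 0) (at 0)"
    by (intro holomorphic_derivI) auto
  have "deriv \<phi> z = \<psi> z + z * deriv \<psi> z" if "z \<in> ball 0 1" for z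
  proof (rule DERIV_imp_deriv)
    have "\<phi> = (\<lambda>z. \<phi> 0 + z * \<psi> z)"
      unfolding \<psi>_def by (rule ext) (rule divdiff_expand)
    moreover have "((\<lambda>z. \<phi> 0 + z * \<psi> z) has_field_derivative \<psi> z + z * deriv \<psi> z) (at z)"
      using D[OF that] by (auto intro!: derivative_eq_intros)
    ultimately show "(\<phi> has_field_derivative \<psi> z + z * deriv \<psi> z) (at z)" by metis
  qed
  moreover have "((\<lambda>z. \<psi> z + z * deriv \<psi> z) has_field_derivative 2 * deriv \<psi> 0) (at 0)"
    using D[of 0] D' by (auto intro!: derivative_eq_intros)
  ultimately have "(deriv \<phi> has_field_derivative 2 * deriv \<psi> 0) (at 0)"
    by (subst has_field_derivative_cong_ev[where g = "\<lambda>z. \<psi> z + z * deriv \<psi> z"])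
      (auto intro!: eventually_mono[OF eventually_nhds_in_open[of "ball 0 1" 0]])
  then show ?thesis
    by (simp add: DERIV_imp_deriv \<psi>_def)
qed

lemma has_field_derivative_square_times_bounded:
  fixes r :: "complex \<Rightarrow> complex"
  assumes "\<And>z. z \<in> ball 0 1 \<Longrightarrow> cmod (r z) \<le> C"
  shows "((\<lambda>z. z\<^sup>2 * r z) has_field_derivative 0) (at 0)"
proof -
  have "((\<lambda>z. z * r z) \<longlongrightarrow> 0) (at 0)"
  proof (rule Lim_null_comparison[where g = "\<lambda>z. cmod z * C"])
    have "\<forall>\<^sub>F z in at (0::complex). z \<in> ball 0 1"
      by (intro eventually_at_in_open') auto
    then show "\<forall>\<^sub>F z in at 0. cmod (z * r z) \<le> cmod z * C"
      by eventually_elim (auto simp: norm_mult intro!: mult_left_mono assms)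
    show "((\<lambda>z::complex. cmod z * C) \<longlongrightarrow> 0) (at 0)"
      by (intro tendsto_mult_left_zero tendsto_norm_zero tendsto_ident_at)
  qed
  then show ?thesis
    unfolding has_field_derivative_iff
    by (rule Lim_transform_eventually)
      (auto simp: eventually_at_filter power2_eq_square)
qed

section \<open>The Taylor polynomial of degree two along a diagonal\<close>

lemma holomorphic2_on_compose:
  assumes f: "f holomorphic2_on bidisc"
    and hol: "\<phi> holomorphic_on ball 0 1" "\<psi> holomorphic_on ball 0 1"
    and map: "\<And>z. z \<in> ball 0 1 \<Longrightarrow> \<phi> z \<in> ball 0 1" "\<And>z. z \<in> ball 0 1 \<Longrightarrow> \<psi> z \<in> ball 0 1"
  shows "(\<lambda>z. f (\<phi> z, \<psi> z)) holomorphic_on ball 0 1"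
proof (rule holomorphic_onI)
  fix z :: complex assume z: "z \<in> ball 0 1"
  have mem: "(\<phi> z, \<psi> z) \<in> bidisc"
    using map z by (simp add: bidisc_def)
  have "open bidisc"
    unfolding bidisc_def by (intro open_Times open_ball)
  with f mem obtain a b where L: "(f has_derivative (\<lambda>(h, k). a * h + b * k)) (at (\<phi> z, \<psi> z))"
    unfolding holomorphic2_on_def by (metis at_within_open)
  obtain c d where "(\<phi> has_field_derivative c) (at z)" "(\<psi> has_field_derivative d) (at z)"
    using holomorphic_derivI[OF hol(1) open_ball z] holomorphic_derivI[OF hol(2) open_ball z]
    by blast
  then have "((\<lambda>z. (\<phi> z, \<psi> z)) has_derivative (\<lambda>h. (c * h, d * h))) (at z)"
    unfolding has_field_derivative_def by (intro has_derivative_Pair)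
  from has_derivative_compose[OF this L]
  have "((\<lambda>z. f (\<phi> z, \<psi> z)) has_derivative (\<lambda>h. (a * c + b * d) * h)) (at z)"
    by (simp add: algebra_simps)
  then show "(\<lambda>z. f (\<phi> z, \<psi> z)) field_differentiable at z within ball 0 1"
    unfolding field_differentiable_def has_field_derivative_def
    by (blast intro: has_derivative_at_withinI)
qed

text \<open>
  Repeated difference quotients in the second variable give
  \<open>F z v = F z 0 + v * F1 z 0 + v\<^sup>2 * F2 z 0 + v ^ 3 * F3 z v\<close>
  with coefficients holomorphic in \<open>z\<close> and \<open>F3\<close> bounded. On \<open>v = w * z\<close> the last term is \<open>O(z ^ 3)\<close>, so
  only one-variable derivatives of the coefficients contribute up to second order. The mixed
  coefficient arises as the derivative in \<open>z\<close> of \<open>F1 z 0\<close>, the partial derivative in \<open>v\<close>.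
\<close>

lemma diagonal_expansion:
  assumes F: "sep_holomorphic_bounded C F"
    and F0: "F 0 0 = 0"
    and w: "cmod w = 1"
    and diag: "(\<lambda>z. F z (w * z)) holomorphic_on ball 0 1"
  shows "divdiff (\<lambda>z. F z (w * z)) 0 = deriv (\<lambda>u. F u 0) 0 + deriv (F 0) 0 * w"
    and "deriv (divdiff (\<lambda>z. F z (w * z))) 0
      = 1/2 * deriv (deriv (\<lambda>u. F u 0)) 0 + deriv (\<lambda>u. deriv (F u) 0) 0 * w
        + 1/2 * deriv (deriv (F 0)) 0 * w\<^sup>2"
proof -
  define q where "q = divdiff (\<lambda>z. F z (w * z))"
  define k where "k = divdiff (\<lambda>u. F u 0)"
  define F1 where "F1 = (\<lambda>u. divdiff (F u))"
  define F2 where "F2 = (\<lambda>u. divdiff (F1 u))"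
  define F3 where "F3 = (\<lambda>u. divdiff (F2 u))"
  have B1: "sep_holomorphic_bounded (2 * C) F1"
    unfolding F1_def by (rule sep_holomorphic_bounded_divdiff[OF F])
  have B2: "sep_holomorphic_bounded (2 * (2 * C)) F2"
    unfolding F2_def by (rule sep_holomorphic_bounded_divdiff[OF B1])
  have B3: "sep_holomorphic_bounded (2 * (2 * (2 * C))) F3"
    unfolding F3_def by (rule sep_holomorphic_bounded_divdiff[OF B2])
  have wz: "w * z \<in> ball 0 1" if "z \<in> ball 0 1" for z
    using that w by (simp add: norm_mult)
  define R where "R = (\<lambda>z. k z + w * F1 z 0 + w\<^sup>2 * (z * F2 z 0) + w ^ 3 * (z\<^sup>2 * F3 z (w * z)))"
  have expand: "F z v = z * k z + v * F1 z 0 + v\<^sup>2 * F2 z 0 + v ^ 3 * F3 z v" for z v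
  proof -
    have "F z v = F z 0 + v * F1 z v"
      unfolding F1_def by (rule divdiff_expand)
    moreover have "F z 0 = z * k z"
      using divdiff_expand[of "\<lambda>u. F u 0" z] by (simp add: k_def F0)
    moreover have "F1 z v = F1 z 0 + v * F2 z v"
      unfolding F2_def by (rule divdiff_expand)
    moreover have "F2 z v = F2 z 0 + v * F3 z v"
      unfolding F3_def by (rule divdiff_expand)
    ultimately show ?thesis
      by (simp add: algebra_simps power2_eq_square power3_eq_cube)
  qed
  have qR: "q z = R z" if "z \<noteq> 0" for z
  proof -
    have "F z (w * z) = z * q z"
      using divdiff_expand[of "\<lambda>z. F z (w * z)" z] unfolding q_def by (simp add: F0)
    moreover have "F z (w * z) = z * R z"
      unfolding expand[of z "w * z"] R_def
      by (simp add: algebra_simps power2_eq_square power3_eq_cube)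
    ultimately have "z * q z = z * R z" by metis
    with that show ?thesis by simp
  qed
  have dk: "(k has_field_derivative deriv k 0) (at 0)"
    unfolding k_def using F
    by (intro holomorphic_derivI[where S = "ball 0 1"] holomorphic_divdiff)
      (auto simp: sep_holomorphic_bounded_def)
  have d1: "((\<lambda>u. F1 u 0) has_field_derivative deriv (\<lambda>u. F1 u 0) 0) (at 0)"
    using B1 by (intro holomorphic_derivI[where S = "ball 0 1"])
      (auto simp: sep_holomorphic_bounded_def)
  have d2: "((\<lambda>u. F2 u 0) has_field_derivative deriv (\<lambda>u. F2 u 0) 0) (at 0)"
    using B2 by (intro holomorphic_derivI[where S = "ball 0 1"])
      (auto simp: sep_holomorphic_bounded_def)
  have d3: "((\<lambda>z. z\<^sup>2 * F3 z (w * z)) has_field_derivative 0) (at 0)"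
    using B3 wz
    by (intro has_field_derivative_square_times_bounded[where C = "2 * (2 * (2 * C))"])
      (auto simp: sep_holomorphic_bounded_def)
  have dR: "(R has_field_derivative
      deriv k 0 + w * deriv (\<lambda>u. F1 u 0) 0 + w\<^sup>2 * F2 0 0) (at 0)"
  proof -
    have "((\<lambda>z. z * F2 z 0) has_field_derivative F2 0 0) (at 0)"
      using DERIV_mult[OF DERIV_ident d2] by simp
    from DERIV_add[OF DERIV_add[OF DERIV_add[OF dk DERIV_cmult[OF d1, of w]]
        DERIV_cmult[OF this, of "w\<^sup>2"]] DERIV_cmult[OF d3, of "w ^ 3"]]
    show ?thesis by (simp add: R_def)
  qed
  have holq: "q holomorphic_on ball 0 1"
    unfolding q_def by (rule holomorphic_divdiff[OF diag])
  \<comment> \<open>The expansion determines \<open>q\<close> away from the origin only; both sides are continuous there.\<close>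
  then have "isCont q 0"
    by (intro field_differentiable_imp_continuous_at)
      (auto intro!: holomorphic_on_imp_differentiable_at[where s = "ball 0 1"])
  then have "(q \<longlongrightarrow> q 0) (at 0)"
    by (simp add: isCont_def)
  moreover have "(R \<longlongrightarrow> R 0) (at 0)"
    using DERIV_isCont[OF dR] by (simp add: isCont_def)
  then have "(q \<longlongrightarrow> R 0) (at 0)"
    by (rule Lim_transform_eventually) (auto simp: eventually_at_filter qR)
  ultimately have q0: "q 0 = R 0"
    by (rule tendsto_unique[OF at_neq_bot])
  have "q = R"
  proof
    show "q z = R z" for z using qR[of z] q0 by (cases "z = 0") auto
  qed
  with dR have dq: "deriv q 0 = deriv k 0 + w * deriv (\<lambda>u. F1 u 0) 0 + w\<^sup>2 * F2 0 0"
    by (simp add: DERIV_imp_deriv)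
  have hol: "(\<lambda>u. F u 0) holomorphic_on ball 0 1" "F 0 holomorphic_on ball 0 1"
    using F by (auto simp: sep_holomorphic_bounded_def)
  have "q 0 = deriv (\<lambda>u. F u 0) 0 + deriv (F 0) 0 * w"
    unfolding q0 by (simp add: R_def k_def F1_def divdiff_0 mult.commute)
  then show "divdiff (\<lambda>z. F z (w * z)) 0 = deriv (\<lambda>u. F u 0) 0 + deriv (F 0) 0 * w"
    by (simp add: q_def)
  have "F2 0 0 = 1/2 * deriv (deriv (F 0)) 0"
    using half_second_deriv[OF hol(2)] by (simp add: F2_def F1_def divdiff_0)
  moreover have "deriv k 0 = 1/2 * deriv (deriv (\<lambda>u. F u 0)) 0"
    unfolding k_def by (rule half_second_deriv[OF hol(1)])
  moreover have "(\<lambda>u. F1 u 0) = (\<lambda>u. deriv (F u) 0)"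
    by (simp add: F1_def divdiff_0)
  ultimately show "deriv (divdiff (\<lambda>z. F z (w * z))) 0
      = 1/2 * deriv (deriv (\<lambda>u. F u 0)) 0 + deriv (\<lambda>u. deriv (F u) 0) 0 * w
        + 1/2 * deriv (deriv (F 0)) 0 * w\<^sup>2"
    unfolding q_def[symmetric] dq by (simp only: mult.commute[of w] mult.commute[of "w\<^sup>2"])
qed

text \<open>
  For \<open>w\<close> on the unit circle the slice \<open>z \<mapsto> f (z, w * z)\<close> maps the disc to the closed disc and
  vanishes at the origin. By the Schwarz lemma its quotient by \<open>z\<close> is bounded by one as well, and the
  inequality is Schwarz-Pick for that quotient at the origin.
\<close>

lemma symbol_Schwarz_Pick:
  assumes f: "f holomorphic2_on bidisc"
    and f0: "f 0 = 0"
    and bd: "\<forall>z\<in>bidisc. cmod (f z) \<le> 1"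
    and w: "cmod w = 1"
  shows "cmod (1/2 * pd1 (pd1 f) 0 + pd1 (pd2 f) 0 * w + 1/2 * pd2 (pd2 f) 0 * w\<^sup>2)
      \<le> 1 - (cmod (pd1 f 0 + pd2 f 0 * w))\<^sup>2"
proof -
  define F where "F = (\<lambda>u v. f (u, v))"
  define g where "g = (\<lambda>z. F z (w * z))"
  have wz: "w * z \<in> ball 0 1" if "z \<in> ball 0 1" for z
    using that w by (simp add: norm_mult)
  have F: "sep_holomorphic_bounded 1 F"
    unfolding sep_holomorphic_bounded_def F_def
    using bd by (auto intro!: holomorphic2_on_compose[OF f] holomorphic_intros simp: bidisc_def)
  have g: "g holomorphic_on ball 0 1"
    unfolding g_def F_def using wz
    by (intro holomorphic2_on_compose[OF f] holomorphic_intros) auto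
  have F0: "F 0 0 = 0"
    using f0 by (simp add: F_def zero_prod_def)
  have "cmod (divdiff g z) \<le> 1" if "z \<in> ball 0 1" for z
  proof (rule norm_divdiff_le[OF g _ that])
    fix z :: complex assume "z \<in> ball 0 1"
    with F wz show "cmod (g z - g 0) \<le> 1"
      by (simp add: g_def F0 sep_holomorphic_bounded_def)
  qed
  from Schwarz_Pick_origin[OF holomorphic_divdiff[OF g] this]
  have "cmod (deriv (divdiff g) 0) \<le> 1 - (cmod (divdiff g 0))\<^sup>2" .
  moreover have "divdiff g 0 = pd1 f 0 + pd2 f 0 * w"
    unfolding g_def diagonal_expansion(1)[OF F F0 w g[unfolded g_def]]
    by (simp add: pd1_def pd2_def F_def zero_prod_def)
  moreover have "deriv (divdiff g) 0
      = 1/2 * pd1 (pd1 f) 0 + pd1 (pd2 f) 0 * w + 1/2 * pd2 (pd2 f) 0 * w\<^sup>2"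
    unfolding g_def diagonal_expansion(2)[OF F F0 w g[unfolded g_def]]
    by (simp add: pd1_def pd2_def F_def zero_prod_def)
  ultimately show ?thesis by simp
qed

section \<open>Polynomials in the shift and their symbols\<close>

text \<open>
  With \<open>a = cmod \<alpha>\<close> the gap between the two sides is at least
  \<open>(1 - a\<^sup>2) * (cmod u - a * cmod v)\<^sup>2\<close>.
\<close>

lemma triangular_toeplitz_contraction:
  fixes \<alpha> \<beta> u v :: complex
  assumes "cmod \<beta> \<le> 1 - (cmod \<alpha>)\<^sup>2"
  shows "(cmod (\<alpha> * u + \<beta> * v))\<^sup>2 + (cmod (\<alpha> * v))\<^sup>2 \<le> (cmod u)\<^sup>2 + (cmod v)\<^sup>2"
proof -
  define a s t where "a = cmod \<alpha>" and "s = cmod u" and "t = cmod v"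
  have "cmod (\<alpha> * u + \<beta> * v) \<le> a * s + cmod \<beta> * t"
    unfolding a_def s_def t_def by (metis norm_mult norm_triangle_ineq)
  also have "\<dots> \<le> a * s + (1 - a\<^sup>2) * t"
    using assms by (auto simp: a_def t_def intro: mult_right_mono)
  finally have "(cmod (\<alpha> * u + \<beta> * v))\<^sup>2 \<le> (a * s + (1 - a\<^sup>2) * t)\<^sup>2"
    by (rule power_mono) simp
  moreover have "(s\<^sup>2 + t\<^sup>2) - ((a * s + (1 - a\<^sup>2) * t)\<^sup>2 + (a * t)\<^sup>2) = (1 - a\<^sup>2) * (s - a * t)\<^sup>2"
    by (simp add: power2_eq_square algebra_simps)
  moreover have "0 \<le> (1 - a\<^sup>2) * (s - a * t)\<^sup>2"
    using order_trans[OF norm_ge_zero assms] by (simp add: a_def)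
  moreover have "(cmod (\<alpha> * v))\<^sup>2 = (a * t)\<^sup>2"
    by (simp add: a_def t_def norm_mult)
  ultimately show ?thesis
    unfolding s_def t_def by linarith
qed

lemma sum_cis_roots_of_unity:
  fixes d :: int
  assumes N: "0 < N" and d: "\<not> int N dvd d"
  shows "(\<Sum>k<N. cis (2 * pi * real k / real N * of_int d)) = 0"
proof -
  define z where "z = cis (2 * pi * of_int d / real N)"
  have pow: "z ^ k = cis (2 * pi * real k / real N * of_int d)" for k
    by (simp add: z_def Complex.DeMoivre mult_ac)
  have "z ^ N = cis (2 * pi * of_int d)"
    using N by (simp add: pow)
  also have "\<dots> = 1"
    by (rule cis_multiple_2pi) simp
  finally have zN: "z ^ N = 1" .
  have "z \<noteq> 1"
  proof
    assume "z = 1"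
    then have "cos (2 * pi * of_int d / real N) = 1"
      unfolding z_def by (metis cis.sel(1) one_complex.sel(1))
    then obtain n :: int where "2 * pi * of_int d / real N = of_int n * 2 * pi"
      using cos_one_2pi_int by auto
    then have "of_int d = (of_int n * of_int (int N) :: real)"
      using N by (simp add: field_simps)
    then have "d = n * int N"
      by (metis of_int_eq_iff of_int_mult)
    with d show False by simp
  qed
  then have "(\<Sum>k<N. z ^ k) = 0"
    by (simp add: geometric_sum zN)
  then show ?thesis by (simp add: pow)
qed

text \<open>
  Distinct indices of a window of length \<open>N\<close> are incongruent modulo \<open>N\<close>, so the characters at the
  \<open>N\<close>-th roots of unity are orthogonal on the window.
\<close>

lemma finite_Parseval:
  fixes x :: "int \<Rightarrow> complex" and m :: int
  assumes N: "0 < N"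
  shows "(\<Sum>k<N. (cmod (\<Sum>n\<in>{m..<m + int N}. x n * cis (- (2 * pi * real k / real N * of_int n))))\<^sup>2)
    = real N * (\<Sum>n\<in>{m..<m + int N}. (cmod (x n))\<^sup>2)"
proof -
  let ?J = "{m..<m + int N}"
  define E where "E = (\<lambda>(k::nat) (n::int). cis (- (2 * pi * real k / real N * of_int n)))"
  have orth: "(\<Sum>k<N. E k n * cnj (E k l)) = (if n = l then of_nat N else 0)"
    if "n \<in> ?J" "l \<in> ?J" for n l
  proof (cases "n = l")
    case True
    then show ?thesis by (simp add: E_def cis_cnj cis_mult)
  next
    case False
    have "\<not> int N dvd l - n"
    proof
      assume "int N dvd l - n"
      then have "int N \<le> \<bar>l - n\<bar>"
        using False by (intro zdvd_imp_le[of "int N" "\<bar>l - n\<bar>"]) auto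
      with that show False by auto
    qed
    moreover have "E k n * cnj (E k l) = cis (2 * pi * real k / real N * of_int (l - n))" for k
      by (simp add: E_def cis_cnj cis_mult algebra_simps diff_divide_distrib)
    ultimately show ?thesis
      using False sum_cis_roots_of_unity[OF N] by (simp only: if_False)
  qed
  have "complex_of_real (\<Sum>k<N. (cmod (\<Sum>n\<in>?J. x n * E k n))\<^sup>2)
      = (\<Sum>k<N. \<Sum>n\<in>?J. \<Sum>l\<in>?J. x n * cnj (x l) * (E k n * cnj (E k l)))"
    by (simp add: complex_norm_square sum_product mult_ac del: of_real_power)
  also have "\<dots> = (\<Sum>n\<in>?J. \<Sum>l\<in>?J. x n * cnj (x l) * (\<Sum>k<N. E k n * cnj (E k l)))"
    by (simp add: sum_distrib_left sum.swap[of _ _ "{..<N}"])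
  also have "\<dots> = (\<Sum>n\<in>?J. \<Sum>l\<in>?J. if n = l then of_nat N * (x n * cnj (x n)) else 0)"
    by (intro sum.cong refl) (simp add: orth del: atLeastLessThan_iff)
  also have "\<dots> = (\<Sum>n\<in>?J. of_nat N * (x n * cnj (x n)))"
    by (simp add: sum.delta)
  also have "\<dots> = complex_of_real (real N * (\<Sum>n\<in>?J. (cmod (x n))\<^sup>2))"
    by (simp add: complex_norm_square sum_distrib_left del: of_real_power)
  finally show ?thesis
    unfolding E_def of_real_eq_iff .
qed

text \<open>
  On the Fourier side a translation becomes multiplication by a character, exactly and not just up to
  boundary terms, because \<open>x\<close> vanishes on the first \<open>j\<close> places of the window.
\<close>

lemma sum_shift_cis:
  fixes x :: "int \<Rightarrow> complex" and m M j :: int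
  assumes "0 \<le> j" and supp: "\<And>n. n \<notin> {m + j..<M} \<Longrightarrow> x n = 0"
  shows "(\<Sum>n\<in>{m..<M}. x (n + j) * cis (- (t * of_int n)))
    = cis (t * of_int j) * (\<Sum>n\<in>{m..<M}. x n * cis (- (t * of_int n)))"
proof -
  have "(\<Sum>n\<in>{m..<M}. x (n + j) * cis (- (t * of_int n)))
      = (\<Sum>n\<in>{m..<M - j}. x (n + j) * cis (- (t * of_int n)))"
    using assms by (intro sum.mono_neutral_right) auto
  also have "\<dots> = (\<Sum>n\<in>{m + j..<M}. x n * cis (- (t * of_int (n - j))))"
    by (rule sum.reindex_bij_witness[of _ "\<lambda>n. n - j" "\<lambda>n. n + j"]) auto
  also have "\<dots> = (\<Sum>n\<in>{m..<M}. x n * cis (- (t * of_int (n - j))))"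
    using assms by (intro sum.mono_neutral_left) auto
  also have "\<dots> = cis (t * of_int j) * (\<Sum>n\<in>{m..<M}. x n * cis (- (t * of_int n)))"
    by (simp add: sum_distrib_left cis_mult algebra_simps mult.left_commute[of "cis _" "x _"])
  finally show ?thesis .
qed

text \<open>
  For sequences supported in a window of length \<open>N\<close>, the Fourier transform over the \<open>N\<close>-th roots of unity
  multiplies squared norms by \<open>N\<close> and turns the operator into multiplication by the scalar triangular
  matrices formed from the symbols. Each of these is a contraction by assumption. The support
  starts two places late, as the operator moves entries to the left by at most two places.
\<close>

lemma translation_symbol_contraction:
  fixes x y :: "int \<Rightarrow> complex" and m :: int
  assumes symbol: "\<And>w. cmod w = 1 \<Longrightarrow>
      cmod (b0 + b1 * w + b2 * w\<^sup>2) \<le> 1 - (cmod (a0 + a1 * w))\<^sup>2"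
    and N: "0 < N"
    and supp: "\<And>n. n \<notin> {m + 2..<m + int N} \<Longrightarrow> x n = 0"
      "\<And>n. n \<notin> {m + 2..<m + int N} \<Longrightarrow> y n = 0"
  shows "(\<Sum>n\<in>{m..<m + int N}.
        (cmod (a0 * x n + a1 * x (n + 1) + (b0 * y n + b1 * y (n + 1) + b2 * y (n + 2))))\<^sup>2
        + (cmod (a0 * y n + a1 * y (n + 1)))\<^sup>2)
    \<le> (\<Sum>n\<in>{m..<m + int N}. (cmod (x n))\<^sup>2 + (cmod (y n))\<^sup>2)"
proof -
  let ?J = "{m..<m + int N}"
  define \<theta> where "\<theta> = (\<lambda>k::nat. 2 * pi * real k / real N)"
  define H where "H = (\<lambda>(z :: int \<Rightarrow> complex) k. \<Sum>n\<in>?J. z n * cis (- (\<theta> k * of_int n)))"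
  define U where "U = (\<lambda>n. a0 * x n + a1 * x (n + 1) + (b0 * y n + b1 * y (n + 1) + b2 * y (n + 2)))"
  define V where "V = (\<lambda>n. a0 * y n + a1 * y (n + 1))"
  have parseval: "(\<Sum>k<N. (cmod (H z k))\<^sup>2) = real N * (\<Sum>n\<in>?J. (cmod (z n))\<^sup>2)" for z
    unfolding H_def \<theta>_def by (rule finite_Parseval[OF N])
  have shift1: "H (\<lambda>n. z (n + 1)) k = cis (\<theta> k) * H z k"
    and shift2: "H (\<lambda>n. z (n + 2)) k = (cis (\<theta> k))\<^sup>2 * H z k"
    if z: "\<And>n. n \<notin> {m + 2..<m + int N} \<Longrightarrow> z n = 0" for z k
  proof -
    show "H (\<lambda>n. z (n + 1)) k = cis (\<theta> k) * H z k"
      using sum_shift_cis[of 1 m "m + int N" z "\<theta> k"] z by (simp add: H_def)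
    show "H (\<lambda>n. z (n + 2)) k = (cis (\<theta> k))\<^sup>2 * H z k"
      using sum_shift_cis[of 2 m "m + int N" z "\<theta> k"] z
      by (simp add: H_def Complex.DeMoivre mult.commute)
  qed
  have add: "H (\<lambda>n. z n + z' n) k = H z k + H z' k" and cmult: "H (\<lambda>n. c * z n) k = c * H z k"
    for z z' c k
    by (simp_all add: H_def distrib_right sum.distrib sum_distrib_left mult.assoc)
  have shifts: "H (\<lambda>n. x (n + 1)) k = cis (\<theta> k) * H x k"
      "H (\<lambda>n. y (n + 1)) k = cis (\<theta> k) * H y k"
      "H (\<lambda>n. y (n + 2)) k = (cis (\<theta> k))\<^sup>2 * H y k" for k
    by (rule shift1 shift2; rule supp; assumption)+
  have HV: "H V k = (a0 + a1 * cis (\<theta> k)) * H y k" for k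
    unfolding V_def add cmult shifts by (simp only: distrib_right mult.assoc)
  have HU: "H U k = (a0 + a1 * cis (\<theta> k)) * H x k
      + (b0 + b1 * cis (\<theta> k) + b2 * (cis (\<theta> k))\<^sup>2) * H y k" for k
    unfolding U_def add cmult shifts by (simp only: distrib_right mult.assoc)
  have "real N * (\<Sum>n\<in>?J. (cmod (U n))\<^sup>2 + (cmod (V n))\<^sup>2)
      = (\<Sum>k<N. (cmod (H U k))\<^sup>2 + (cmod (H V k))\<^sup>2)"
    by (simp add: sum.distrib parseval distrib_left)
  also have "\<dots> \<le> (\<Sum>k<N. (cmod (H x k))\<^sup>2 + (cmod (H y k))\<^sup>2)"
    unfolding HU HV by (intro sum_mono triangular_toeplitz_contraction symbol) simp
  also have "\<dots> = real N * (\<Sum>n\<in>?J. (cmod (x n))\<^sup>2 + (cmod (y n))\<^sup>2)"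
    by (simp add: sum.distrib parseval distrib_left)
  finally show ?thesis
    using N by (simp add: U_def V_def)
qed

text \<open>
  A finite set of output entries depends on finitely many input entries only. Truncating the input to
  those does not change the chosen outputs and does not increase the input norm, so the finitely
  supported case bounds every partial sum.
\<close>

lemma translation_symbol_contraction_infsum:
  fixes x y :: "int \<Rightarrow> complex" and a0 a1 b0 b1 b2 :: complex
  defines "U \<equiv> \<lambda>n. a0 * x n + a1 * x (n + 1) + (b0 * y n + b1 * y (n + 1) + b2 * y (n + 2))"
    and "V \<equiv> \<lambda>n. a0 * y n + a1 * y (n + 1)"
  assumes symbol: "\<And>w. cmod w = 1 \<Longrightarrow>
      cmod (b0 + b1 * w + b2 * w\<^sup>2) \<le> 1 - (cmod (a0 + a1 * w))\<^sup>2"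
    and xy: "(\<lambda>n. (cmod (x n))\<^sup>2 + (cmod (y n))\<^sup>2) summable_on UNIV"
    and UV: "(\<lambda>n. (cmod (U n))\<^sup>2 + (cmod (V n))\<^sup>2) summable_on UNIV"
  shows "(\<Sum>\<^sub>\<infinity>n. (cmod (U n))\<^sup>2 + (cmod (V n))\<^sup>2) \<le> (\<Sum>\<^sub>\<infinity>n. (cmod (x n))\<^sup>2 + (cmod (y n))\<^sup>2)"
proof (rule infsum_le_finite_sums[OF UV])
  fix A :: "int set" assume A: "finite A"
  define M where "M = Max (insert 0 (abs ` A))"
  have M: "\<bar>n\<bar> \<le> M" if "n \<in> A" for n
    unfolding M_def using A that by (intro Max_ge) auto
  have M0: "0 \<le> M"
    unfolding M_def using A by (intro Max_ge) auto
  define W where "W = {- M..<M + 3}"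
  define x' where "x' = (\<lambda>n. if n \<in> W then x n else 0)"
  define y' where "y' = (\<lambda>n. if n \<in> W then y n else 0)"
  \<comment> \<open>\<open>N\<close> is the length of the window \<open>{- M - 2..<M + 3}\<close>, which is \<open>W\<close> with two extra places on the left.\<close>
  define N where "N = nat (2 * M + 5)"
  have end_eq: "- M - 2 + int N = M + 3" and start_eq: "- M - 2 + 2 = - M"
    using M0 by (simp_all add: N_def)
  let ?U = "\<lambda>n. a0 * x' n + a1 * x' (n + 1) + (b0 * y' n + b1 * y' (n + 1) + b2 * y' (n + 2))"
  let ?V = "\<lambda>n. a0 * y' n + a1 * y' (n + 1)"
  have W: "n \<in> W" "n + 1 \<in> W" "n + 2 \<in> W" if "n \<in> A" for n
    using M[OF that] by (auto simp: W_def)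
  have "(\<Sum>n\<in>A. (cmod (U n))\<^sup>2 + (cmod (V n))\<^sup>2) = (\<Sum>n\<in>A. (cmod (?U n))\<^sup>2 + (cmod (?V n))\<^sup>2)"
    by (intro sum.cong refl) (simp add: U_def V_def x'_def y'_def W)
  also have "\<dots> \<le> (\<Sum>n\<in>{- M - 2..<M + 3}. (cmod (?U n))\<^sup>2 + (cmod (?V n))\<^sup>2)"
    using W(1) by (intro sum_mono2) (force simp: W_def)+
  also have "\<dots> \<le> (\<Sum>n\<in>{- M - 2..<M + 3}. (cmod (x' n))\<^sup>2 + (cmod (y' n))\<^sup>2)"
  proof (rule translation_symbol_contraction[OF symbol, where m = "- M - 2" and N = N,
        unfolded end_eq start_eq])
    show "0 < N" using M0 by (simp add: N_def)
  qed (auto simp: x'_def y'_def W_def)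
  also have "\<dots> \<le> (\<Sum>n\<in>{- M - 2..<M + 3}. (cmod (x n))\<^sup>2 + (cmod (y n))\<^sup>2)"
    by (intro sum_mono) (simp add: x'_def y'_def)
  also have "\<dots> \<le> (\<Sum>\<^sub>\<infinity>n. (cmod (x n))\<^sup>2 + (cmod (y n))\<^sup>2)"
    by (rule finite_sum_le_infsum[OF xy]) auto
  finally show "(\<Sum>n\<in>A. (cmod (U n))\<^sup>2 + (cmod (V n))\<^sup>2) \<le> (\<Sum>\<^sub>\<infinity>n. (cmod (x n))\<^sup>2 + (cmod (y n))\<^sup>2)" .
qed

lemma norm_square_Pair_ell2:
  fixes u v :: "'a ell2"
  shows "(norm (u, v))\<^sup>2 = (\<Sum>\<^sub>\<infinity>i. (cmod (coord u i))\<^sup>2 + (cmod (coord v i))\<^sup>2)"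
proof -
  have "(norm u)\<^sup>2 = (\<Sum>\<^sub>\<infinity>i. (cmod (coord u i))\<^sup>2)" for u :: "'a ell2"
    unfolding norm_ell2_def by (simp add: infsum_nonneg)
  then show ?thesis
    by (simp add: norm_Pair infsum_add coord_square_summable infsum_nonneg)
qed

lemma norm_block_op_translation_le_1:
  assumes symbol: "\<And>w. cmod w = 1 \<Longrightarrow>
      cmod (b0 + b1 * w + b2 * w\<^sup>2) \<le> 1 - (cmod (a0 + a1 * w))\<^sup>2"
  shows "norm (block_op
      (a0 *\<^sub>C id_blinfun + a1 *\<^sub>C adj bilateral_shift)
      (b0 *\<^sub>C id_blinfun + b1 *\<^sub>C adj bilateral_shift
        + b2 *\<^sub>C (adj bilateral_shift o\<^sub>L adj bilateral_shift))) \<le> 1"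
    (is "norm ?T \<le> 1")
proof (rule norm_blinfun_bound)
  fix z :: "int ell2 \<times> int ell2"
  obtain x y where z: "z = (x, y)" by (cases z)
  obtain u v where uv: "blinfun_apply ?T z = (u, v)" by fastforce
  have shift: "coord (blinfun_apply (adj bilateral_shift) s) n = coord s (n + 1)" for s n
    by (simp add: adj_bilateral_shift bounded_linear_Blinfun_apply bounded_linear_translate
        translate.rep_eq add.commute)
  have ops: "coord (blinfun_apply (a0 *\<^sub>C id_blinfun + a1 *\<^sub>C adj bilateral_shift) s) n
        = a0 * coord s n + a1 * coord s (n + 1)"
      "coord (blinfun_apply (b0 *\<^sub>C id_blinfun + b1 *\<^sub>C adj bilateral_shift
        + b2 *\<^sub>C (adj bilateral_shift o\<^sub>L adj bilateral_shift)) s) n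
        = b0 * coord s n + b1 * coord s (n + 1) + b2 * coord s (n + 2)" for s n
    by (simp_all add: blinfun.add_left blinfun_apply_cscale_op plus_ell2.rep_eq scaleC.rep_eq shift add.assoc)
  have u: "coord u = (\<lambda>n. a0 * coord x n + a1 * coord x (n + 1)
      + (b0 * coord y n + b1 * coord y (n + 1) + b2 * coord y (n + 2)))"
    and v: "coord v = (\<lambda>n. a0 * coord y n + a1 * coord y (n + 1))"
    using uv by (auto simp: z blinfun_apply_block_op plus_ell2.rep_eq ops)
  have summ: "(\<lambda>n. (cmod (coord s n))\<^sup>2 + (cmod (coord t n))\<^sup>2) summable_on UNIV"
    for s t :: "int ell2"
    by (intro summable_on_add coord_square_summable)
  have "(norm (u, v))\<^sup>2 \<le> (norm (x, y))\<^sup>2"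
    unfolding norm_square_Pair_ell2
    using translation_symbol_contraction_infsum[OF symbol summ[of x y] summ[of u v, unfolded u v]]
    by (simp only: u v)
  then have "norm (u, v) \<le> norm (x, y)"
    by (rule power2_le_imp_le) simp
  then show "norm (blinfun_apply ?T z) \<le> 1 * norm z"
    unfolding uv by (simp add: z)
qed simp

section \<open>The norm estimate\<close>

theorem theorem3p9:
  fixes f :: "complex \<times> complex \<Rightarrow> complex"
  assumes "f holomorphic2_on bidisc"
    and "f 0 = 0"
    and "\<forall>z\<in>bidisc. cmod (f z) \<le> 1"
  shows "norm (block_op
      (pd1 f 0 *\<^sub>C id_blinfun + pd2 f 0 *\<^sub>C adj bilateral_shift)
      ((1/2 * pd1 (pd1 f) 0) *\<^sub>C id_blinfun
        + pd1 (pd2 f) 0 *\<^sub>C adj bilateral_shift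
        + (1/2 * pd2 (pd2 f) 0) *\<^sub>C (adj bilateral_shift o\<^sub>L adj bilateral_shift))) \<le> 1"
  by (rule norm_block_op_translation_le_1) (rule symbol_Schwarz_Pick[OF assms])

end
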